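(* Let $k\geq 1$ and let $p$ be a prime number. Let $\Phi$ be a $k$-vertex graph property that is monotone and not $k$-trivial. Then there is a $k$-vertex graph $H$ such that $\widehat{\Phi}(H)\not\equiv 0\pmod p$ and the complete bipartite graph $K_{\ell,\ell}$ is a subgraph of $H$ for some $\ell>k/p^2$.
   Context: All graphs are finite, simple and undirected. A $k$-vertex graph property is an isomorphism-invariant map $\Phi$ from graphs to $\{0,1\}$ with $\Phi(G)=0$ whenever $|V(G)|\neq k$. It is monotone if $\Phi(G)=1$ implies $\Phi((V(G),S))=1$ for all $S\subseteq E(G)$, and $k$-trivial if it is constant on all $k$-vertex graphs. The alternating enumerator of $\Phi$ on a graph $H$ is the integer $\widehat{\Phi}(H)=(-1)^{|E(H)|}\sum_{S\subseteq E(H)}(-1)^{|S|}\Phi(H[S])$, where $H[S]=(V(H),S)$. *)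

theory Defs
  imports Complex_Main "HOL-Number_Theory.Cong"
begin

text \<open>A graph is a pair of a vertex set and a set of two-element edges. The vertex type is
  arbitrary; a type with fewer than \<open>k\<close> elements carries no \<open>k\<close>-vertex graph, and
  every \<open>k\<close>-vertex graph property over it is \<open>k\<close>-trivial.\<close>

type_synonym 'a graph = "'a set \<times> 'a set set"

abbreviation verts :: "'a graph \<Rightarrow> 'a set" where
  "verts \<equiv> fst"

abbreviation edges :: "'a graph \<Rightarrow> 'a set set" where
  "edges \<equiv> snd"

definition fin_simple_graph :: "'a graph \<Rightarrow> bool" where
  "fin_simple_graph G \<longleftrightarrow>
     finite (verts G) \<and> (\<forall>e\<in>edges G. e \<subseteq> verts G \<and> card e = 2)"

definition graph_iso :: "'a graph \<Rightarrow> 'a graph \<Rightarrow> bool" where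
  "graph_iso G H \<longleftrightarrow>
     (\<exists>f. bij_betw f (verts G) (verts H) \<and>
          (\<forall>u\<in>verts G. \<forall>v\<in>verts G. {u, v} \<in> edges G \<longleftrightarrow> {f u, f v} \<in> edges H))"

definition subgraph :: "'a graph \<Rightarrow> 'a graph \<Rightarrow> bool" where
  "subgraph G H \<longleftrightarrow> verts G \<subseteq> verts H \<and> edges G \<subseteq> edges H"

text \<open>\<open>K\<close> is a copy of the complete bipartite graph with parts of sizes \<open>m\<close> and \<open>n\<close>.\<close>

definition complete_bipartite :: "nat \<Rightarrow> nat \<Rightarrow> 'a graph \<Rightarrow> bool" where
  "complete_bipartite m n K \<longleftrightarrow>
     (\<exists>A B. finite A \<and> finite B \<and> A \<inter> B = {} \<and> card A = m \<and> card B = n \<and>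
            K = (A \<union> B, {{a, b} |a b. a \<in> A \<and> b \<in> B}))"

definition spanning_subgraph :: "'a graph \<Rightarrow> 'a set set \<Rightarrow> 'a graph" where
  "spanning_subgraph H S = (verts H, S)"

text \<open>Values of \<open>\<Phi>\<close> on pairs that are not finite simple graphs are unconstrained, and
  none of the notions below depends on them.\<close>

definition graph_property :: "nat \<Rightarrow> ('a graph \<Rightarrow> int) \<Rightarrow> bool" where
  "graph_property k \<Phi> \<longleftrightarrow>
     (\<forall>G. fin_simple_graph G \<longrightarrow> \<Phi> G \<in> {0, 1}) \<and>
     (\<forall>G H. fin_simple_graph G \<longrightarrow> fin_simple_graph H \<longrightarrow> graph_iso G H \<longrightarrow> \<Phi> G = \<Phi> H) \<and>
     (\<forall>G. fin_simple_graph G \<longrightarrow> card (verts G) \<noteq> k \<longrightarrow> \<Phi> G = 0)"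

definition monotone_property :: "('a graph \<Rightarrow> int) \<Rightarrow> bool" where
  "monotone_property \<Phi> \<longleftrightarrow>
     (\<forall>G. fin_simple_graph G \<longrightarrow> \<Phi> G = 1 \<longrightarrow>
        (\<forall>S. S \<subseteq> edges G \<longrightarrow> \<Phi> (spanning_subgraph G S) = 1))"

definition trivial_property :: "nat \<Rightarrow> ('a graph \<Rightarrow> int) \<Rightarrow> bool" where
  "trivial_property k \<Phi> \<longleftrightarrow>
     (\<exists>c. \<forall>G. fin_simple_graph G \<longrightarrow> card (verts G) = k \<longrightarrow> \<Phi> G = c)"

definition alternating_enumerator :: "('a graph \<Rightarrow> int) \<Rightarrow> 'a graph \<Rightarrow> int" where
  "alternating_enumerator \<Phi> H =
     (-1) ^ card (edges H) *
       (\<Sum>S\<in>Pow (edges H). (-1) ^ card S * \<Phi> (spanning_subgraph H S))"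

end

theory Submission
  imports Defs "HOL-Combinatorics.Permutations"
begin

text \<open>Let \<open>p ^ n \<le> k < p ^ (n + 1)\<close> and \<open>s = p ^ (n - 1)\<close> (\<open>s = 1\<close> if \<open>n = 0\<close>), so that
  \<open>s > k / p\<^sup>2\<close>, and suppose that the enumerator vanishes modulo \<open>p\<close> on all graphs containing a
  \<open>K\<^bsub>s,s\<^esub>\<close>. Let cyclic groups of order \<open>s\<close> act transitively on two disjoint sets \<open>A1\<close>, \<open>A2\<close> of
  \<open>s\<close> vertices, fixing the other vertices. Modulo \<open>p\<close> only the invariant edge sets contribute to the
  enumerator of an invariant graph, and a minimal counterexample shows: if an invariant graph without
  edges between \<open>A1\<close> and \<open>A2\<close> has the property, it keeps it when \<open>A1\<close> and \<open>A2\<close> are joined completely.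

  Together with monotonicity, such joins lead from the edgeless graph to the complete graph, so the
  property is trivial. To make a set \<open>T\<close> of \<open>p * s\<close> vertices a clique, suppose that it is a union of
  disjoint cliques of size \<open>p ^ i\<close>. Distribute any \<open>p\<close> of them that are to be merged over \<open>p\<close>
  different blocks of size \<open>s\<close>, join all the blocks, and delete edges to be left with disjoint
  cliques of size \<open>p ^ (i + 1)\<close>. This also works when all vertices of \<open>T\<close> are joined to a clique
  outside. To extend a clique by a vertex \<open>x\<close>, isolate \<open>s - 1\<close> of its vertices, join them
  and \<open>x\<close> to the rest, and apply the previous step to a \<open>T\<close> that contains them and \<open>x\<close>.\<close>

section \<open>Sums over fixed points\<close>

lemma funpow_mult_fixed:
  assumes "(h ^^ m) x = x"
  shows "(h ^^ (m * q)) x = x"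
  using assms by (induction q) (auto simp: funpow_add)

text \<open>A period \<open>m\<close> with \<open>0 < m < p\<close> is invertible modulo
  \<open>p\<close>. Together with the period \<open>p\<close> it would make \<open>h\<close> itself
  fix \<open>x\<close>.\<close>

lemma funpow_prime_inj:
  fixes h :: "'b \<Rightarrow> 'b"
  assumes p: "prime p" and hp: "(h ^^ p) x = x" and hx: "h x \<noteq> x"
  shows "inj_on (\<lambda>i. (h ^^ i) x) {..<p}"
proof -
  have no_period: "(h ^^ m) x \<noteq> x" if "0 < m" "m < p" for m
  proof
    assume hm: "(h ^^ m) x = x"
    have "\<not> p dvd m"
      using that by (auto dest: dvd_imp_le)
    then have "coprime m p"
      using p prime_imp_coprime coprime_commute by blast
    then obtain q where q: "[m * q = 1] (mod p)"
      using cong_solve_coprime_nat by auto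
    have "m * q mod p = 1"
      using q prime_gt_1_nat[OF p] by (simp add: cong_def)
    then have "m * q = Suc (p * (m * q div p))"
      by (metis Suc_eq_plus1 mult_div_mod_eq)
    then have "(h ^^ (m * q)) x = h ((h ^^ (p * (m * q div p))) x)"
      by (metis funpow.simps(2) comp_apply)
    then show False
      using funpow_mult_fixed[OF hm] funpow_mult_fixed[OF hp] hx by simp
  qed
  have "(h ^^ i) x \<noteq> (h ^^ j) x" if "i < j" "j < p" for i j
  proof
    assume eq: "(h ^^ i) x = (h ^^ j) x"
    \<comment> \<open>Applying \<open>h ^^ (p - i)\<close> to both sides of \<open>eq\<close> closes
      the cycle on the left and leaves the excluded period \<open>j - i\<close> on the
      right.\<close>
    have "x = (h ^^ (p - i + i)) x"
      using hp that by simp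
    also have "\<dots> = (h ^^ (p - i)) ((h ^^ j) x)"
      by (simp only: funpow_add comp_apply eq)
    also have "\<dots> = (h ^^ (p - i + j)) x"
      by (simp only: funpow_add comp_apply)
    also have "p - i + j = j - i + p"
      using that by simp
    also have "(h ^^ (j - i + p)) x = (h ^^ (j - i)) x"
      by (simp add: funpow_add hp)
    finally show False
      using no_period[of "j - i"] that less_imp_diff_less[of j p i] by simp
  qed
  then show ?thesis
    by (intro linorder_inj_onI') auto
qed

text \<open>A moved point has exactly \<open>p\<close> points in its orbit, and \<open>f\<close> is
  constant on them, so the orbit contributes a multiple of \<open>p\<close>. Removing it leaves a
  smaller invariant set.\<close>

lemma prime_dvd_sum_moved_points:
  fixes f :: "'b \<Rightarrow> int"
  assumes p: "prime p"
  shows "finite X \<Longrightarrow> h ` X \<subseteq> X \<Longrightarrow> (\<And>x. x \<in> X \<Longrightarrow> (h ^^ p) x = x) \<Longrightarrow>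
    (\<And>x. x \<in> X \<Longrightarrow> f (h x) = f x) \<Longrightarrow> int p dvd sum f {x\<in>X. h x \<noteq> x}"
proof (induction "card X" arbitrary: X rule: less_induct)
  case less
  note hX = less.prems(2) and per = less.prems(3) and inv = less.prems(4)
  show ?case
  proof (cases "\<exists>x\<in>X. h x \<noteq> x")
    case False
    then have "{x\<in>X. h x \<noteq> x} = {}" by auto
    then show ?thesis by (simp only: sum.empty) simp
  next
    case True
    then obtain x where x: "x \<in> X" "h x \<noteq> x" by auto
    define Orb where "Orb = (\<lambda>i. (h ^^ i) x) ` {..<p}"
    have p0: "p > 0" using p prime_gt_0_nat by auto
    have inX: "(h ^^ i) x \<in> X" for i
      using x hX by (induction i) auto
    have inj: "inj_on (\<lambda>i. (h ^^ i) x) {..<p}"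
      using funpow_prime_inj[OF p per[OF x(1)] x(2)] .
    have OX: "Orb \<subseteq> X" using inX by (auto simp: Orb_def)
    have orb: "(h ^^ i) x \<in> Orb" for i
    proof -
      have "(h ^^ i) x = (h ^^ (i mod p + p * (i div p))) x" by simp
      also have "\<dots> = (h ^^ (i mod p)) x"
        using funpow_mult_fixed[OF per[OF x(1)]] by (simp only: funpow_add comp_apply)
      finally show ?thesis using p0 by (auto simp: Orb_def)
    qed
    have closed: "h ` (X - Orb) \<subseteq> X - Orb"
    proof safe
      fix y assume y: "y \<in> X" "y \<notin> Orb"
      show "h y \<in> X" using y hX by auto
      assume "h y \<in> Orb"
      then obtain i where i: "h y = (h ^^ i) x" by (auto simp: Orb_def)
      \<comment> \<open>On \<open>X\<close> the inverse of \<open>h\<close> is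
        \<open>h ^^ (p - 1)\<close>, so a point mapped into the orbit already lies in it.\<close>
      have "y = (h ^^ (p - 1 + 1)) y" using per[OF y(1)] p0 by simp
      also have "\<dots> = (h ^^ (p - 1)) (h y)" by (simp only: funpow_add comp_apply) simp
      also have "\<dots> = (h ^^ (p - 1 + i)) x" by (simp only: i funpow_add comp_apply)
      finally show False using orb y by metis
    qed
    have moved: "h y \<noteq> y" if yO: "y \<in> Orb" for y
    proof
      assume hy: "h y = y"
      obtain i where i: "i < p" "y = (h ^^ i) x" using yO by (auto simp: Orb_def)
      have "(h ^^ (p - i)) y = y" using funpow_mult_fixed[where h = h and m = 1 and x = y and q = "p - i"] hy by simp
      moreover have "(h ^^ (p - i)) y = x"
        using per[OF x(1)] i by (metis comp_apply funpow_add le_add_diff_inverse2 less_imp_le_nat)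
      ultimately show False using x hy by simp
    qed
    have fO: "f ((h ^^ i) x) = f x" for i
      by (induction i) (use inv inX in auto)
    have "sum f Orb = int p * f x"
      unfolding Orb_def by (subst sum.reindex[OF inj]) (simp add: fO)
    moreover have "int p dvd sum f {y\<in>X - Orb. h y \<noteq> y}"
    proof (rule less.hyps)
      show "card (X - Orb) < card X"
        using less.prems(1) x orb[of 0] by (intro psubset_card_mono) auto
    qed (use less.prems closed in auto)
    moreover have "sum f {y\<in>X. h y \<noteq> y} = sum f Orb + sum f {y\<in>X - Orb. h y \<noteq> y}"
    proof -
      have eq: "{y\<in>X. h y \<noteq> y} = Orb \<union> {y\<in>X - Orb. h y \<noteq> y}"
        using OX moved by auto
      show ?thesis
        unfolding eq by (rule sum.union_disjoint) (use less.prems(1) OX finite_subset in auto)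
    qed
    ultimately show ?thesis by simp
  qed
qed

text \<open>Induction on \<open>d\<close>: the \<open>p\<close>-th power of
  \<open>h = g ^^ (p ^ d)\<close> is the identity on \<open>X\<close>, so the points moved by
  \<open>h\<close> cancel modulo \<open>p\<close>. On the remaining set \<open>Y\<close> the
  hypothesis holds with exponent \<open>d\<close>.\<close>

lemma sum_cong_sum_fixed_points:
  fixes f :: "'b \<Rightarrow> int"
  assumes p: "prime p"
  shows "finite X \<Longrightarrow> g ` X \<subseteq> X \<Longrightarrow> (\<And>x. x \<in> X \<Longrightarrow> (g ^^ (p ^ d)) x = x) \<Longrightarrow>
    (\<And>x. x \<in> X \<Longrightarrow> f (g x) = f x) \<Longrightarrow> [sum f X = sum f {x\<in>X. g x = x}] (mod int p)"
proof (induction d arbitrary: X)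
  case 0
  then have "{x\<in>X. g x = x} = X" by auto
  then show ?case by simp
next
  case (Suc d)
  define h where "h = g ^^ (p ^ d)"
  define Y where "Y = {x\<in>X. h x = x}"
  have gX: "(g ^^ i) x \<in> X" if "x \<in> X" for i x
    using that Suc.prems(2) by (induction i) auto
  have gf: "f ((g ^^ i) x) = f x" if "x \<in> X" for i x
    by (induction i) (use that gX Suc.prems(4) in auto)
  have "int p dvd sum f {x\<in>X. h x \<noteq> x}"
  proof (rule prime_dvd_sum_moved_points[OF p Suc.prems(1)])
    show "(h ^^ p) x = x" if "x \<in> X" for x
      using Suc.prems(3)[OF that] by (simp add: h_def funpow_mult mult.commute)
  qed (auto simp: h_def gX gf)
  moreover have "sum f X = sum f Y + sum f {x\<in>X. h x \<noteq> x}"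
  proof -
    have eq: "X = Y \<union> {x\<in>X. h x \<noteq> x}" by (auto simp: Y_def)
    show ?thesis
      by (subst eq, rule sum.union_disjoint) (use Suc.prems(1) in \<open>auto simp: Y_def\<close>)
  qed
  ultimately have "[sum f X = sum f Y] (mod int p)"
    by (simp add: cong_iff_dvd_diff)
  moreover have "[sum f Y = sum f {x\<in>Y. g x = x}] (mod int p)"
  proof (rule Suc.IH)
    show "g ` Y \<subseteq> Y"
    proof safe
      fix x assume "x \<in> Y"
      then have x: "x \<in> X" "h x = x" by (auto simp: Y_def)
      have "h (g x) = g (h x)" by (simp add: h_def funpow_swap1)
      then show "g x \<in> Y" using x Suc.prems(2) by (auto simp: Y_def)
    qed
  qed (use Suc.prems in \<open>auto simp: Y_def h_def\<close>)
  moreover have "{x\<in>Y. g x = x} = {x\<in>X. g x = x}"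
    using funpow_mult_fixed[where h = g and m = 1 and q = "p ^ d"] by (auto simp: Y_def h_def)
  ultimately show ?case by (metis cong_trans)
qed

section \<open>Joining two invariant sets\<close>

definition pairs :: "'v set \<Rightarrow> 'v set set" where
  "pairs V = {e. e \<subseteq> V \<and> card e = 2}"

definition biclique :: "'v set \<Rightarrow> 'v set \<Rightarrow> 'v set set" where
  "biclique A B = {{a, b} |a b. a \<in> A \<and> b \<in> B}"

abbreviation act :: "('u \<Rightarrow> 'v) \<Rightarrow> 'u set set \<Rightarrow> 'v set set" where
  "act g \<equiv> (`) ((`) g)"

text \<open>Since \<open>g\<close> is the identity off \<open>A\<close>, rotations of disjoint sets
  commute and move the two ends of an edge between these sets independently.\<close>

definition rotates :: "nat \<Rightarrow> ('v \<Rightarrow> 'v) \<Rightarrow> 'v set \<Rightarrow> bool" where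
  "rotates s g A \<longleftrightarrow> g permutes A \<and> g ^^ s = id \<and> (\<forall>u\<in>A. \<forall>v\<in>A. \<exists>i. (g ^^ i) u = v)"

lemma pair_in_pairs_iff [simp]: "{u, v} \<in> pairs V \<longleftrightarrow> u \<in> V \<and> v \<in> V \<and> u \<noteq> v"
  by (auto simp: pairs_def card_2_iff doubleton_eq_iff)

lemma pairsE:
  assumes "e \<in> pairs V"
  obtains u v where "e = {u, v}" "u \<in> V" "v \<in> V" "u \<noteq> v"
  using assms by (auto simp: pairs_def card_2_iff)

lemma finite_pairs [simp]: "finite V \<Longrightarrow> finite (pairs V)"
  by (auto simp: pairs_def)

lemma biclique_subset_pairs:
  assumes "A \<subseteq> V" "B \<subseteq> V" "A \<inter> B = {}"
  shows "biclique A B \<subseteq> pairs V"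
  using assms by (auto simp: biclique_def)

lemma card_biclique:
  assumes "A \<inter> B = {}"
  shows "card (biclique A B) = card A * card B"
proof -
  have "biclique A B = (\<lambda>(a, b). {a, b}) ` (A \<times> B)"
    by (auto simp: biclique_def)
  moreover have "inj_on (\<lambda>(a, b). {a, b}) (A \<times> B)"
    using assms by (auto simp: inj_on_def doubleton_eq_iff)
  ultimately show ?thesis
    by (simp add: card_image card_cartesian_product)
qed

section \<open>Permutations acting on edge sets\<close>

lemma act_funpow:
  fixes g :: "'v \<Rightarrow> 'v"
  shows "(act g ^^ i) S = act (g ^^ i) S"
  by (induction i) (auto simp: image_image image_iff)

lemma act_pairs_subset:
  assumes "inj_on f U" "f ` U \<subseteq> V" "S \<subseteq> pairs U"
  shows "act f S \<subseteq> pairs V"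
proof safe
  fix e assume "e \<in> S"
  then obtain u v where "e = {u, v}" "u \<in> U" "v \<in> U" "u \<noteq> v"
    using assms(3) by (blast elim: pairsE)
  then show "f ` e \<in> pairs V"
    using assms(1,2) by (auto dest: inj_onD)
qed

lemma card_act:
  assumes "g permutes V"
  shows "card (act g S) = card S"
  using permutes_inj[OF assms] by (intro card_image) (simp add: inj_on_def inj_image_eq_iff)

lemma act_biclique:
  assumes "g ` A = A" "g ` B = B"
  shows "act g (biclique A B) = biclique A B"
proof
  show "act g (biclique A B) \<subseteq> biclique A B"
    using assms by (force simp: biclique_def)
  show "biclique A B \<subseteq> act g (biclique A B)"
  proof
    fix e assume "e \<in> biclique A B"
    then obtain a b where e: "e = {a, b}" "a \<in> A" "b \<in> B" by (auto simp: biclique_def)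
    then obtain a' b' where ab: "a' \<in> A" "b' \<in> B" "g a' = a" "g b' = b"
      using assms by (metis imageE)
    then have "e = g ` {a', b'}" "{a', b'} \<in> biclique A B"
      using e by (auto simp: biclique_def)
    then show "e \<in> act g (biclique A B)" by blast
  qed
qed

text \<open>By transitivity, rotating the two ends separately carries any edge between the sets to
  any other one, so an invariant edge set contains all of them or none.\<close>

lemma biclique_subset_invariant:
  assumes g1: "rotates s g1 A1" and g2: "rotates s g2 A2" and disj: "A1 \<inter> A2 = {}"
    and inv: "act g1 S = S" "act g2 S = S" and ne: "S \<inter> biclique A1 A2 \<noteq> {}"
  shows "biclique A1 A2 \<subseteq> S"
proof
  fix e assume "e \<in> biclique A1 A2"
  then obtain b1 b2 where e: "e = {b1, b2}" "b1 \<in> A1" "b2 \<in> A2" by (auto simp: biclique_def)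
  obtain a1 a2 where a: "{a1, a2} \<in> S" "a1 \<in> A1" "a2 \<in> A2"
    using ne by (auto simp: biclique_def)
  obtain i where i: "(g1 ^^ i) a1 = b1" using g1 a e by (auto simp: rotates_def)
  obtain j where j: "(g2 ^^ j) a2 = b2" using g2 a e by (auto simp: rotates_def)
  have fix1: "(g1 ^^ i) a2 = a2"
    using funpow_mult_fixed[where h = g1 and m = 1 and q = i and x = a2] g1 a disj
    by (auto simp: rotates_def permutes_def)
  have fix2: "(g2 ^^ j) b1 = b1"
    using funpow_mult_fixed[where h = g2 and m = 1 and q = j and x = b1] g2 e disj
    by (auto simp: rotates_def permutes_def)
  have act_inv: "act (g1 ^^ i) S = S" "act (g2 ^^ j) S = S"
    using funpow_mult_fixed[where h = "act g1" and m = 1 and q = i and x = S]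
      funpow_mult_fixed[where h = "act g2" and m = 1 and q = j and x = S] inv
    by (simp_all add: act_funpow)
  have "(g1 ^^ i) ` {a1, a2} \<in> S" using a(1) act_inv(1) by blast
  then have "{b1, a2} \<in> S" by (simp add: i fix1)
  then have "(g2 ^^ j) ` {b1, a2} \<in> S" using act_inv(2) by blast
  then show "e \<in> S" by (simp add: e j fix2)
qed

text \<open>The assumption to be refuted, in terms of edge sets on a fixed vertex set:
  \<open>w S\<close> stands for the value of the property on the graph with edge set
  \<open>S\<close>. The leading sign of the enumerator is dropped in \<open>vanish\<close>, as it
  does not affect divisibility.\<close>

locale vanishing_enumerator =
  fixes V :: "'v set" and w :: "'v set set \<Rightarrow> int" and p s :: nat
  assumes finite_V: "finite V"
    and prime_p: "prime p"
    and s_power: "\<exists>d. s = p ^ d"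
    and w_range: "S \<subseteq> pairs V \<Longrightarrow> w S = 0 \<or> w S = 1"
    and w_antimono: "S \<subseteq> T \<Longrightarrow> T \<subseteq> pairs V \<Longrightarrow> w T = 1 \<Longrightarrow> w S = 1"
    and w_invariant: "g permutes V \<Longrightarrow> S \<subseteq> pairs V \<Longrightarrow> w (act g S) = w S"
    and vanish: "E \<subseteq> pairs V \<Longrightarrow> A \<subseteq> V \<Longrightarrow> B \<subseteq> V \<Longrightarrow> A \<inter> B = {} \<Longrightarrow> card A = s \<Longrightarrow> card B = s \<Longrightarrow>
      biclique A B \<subseteq> E \<Longrightarrow> int p dvd (\<Sum>S\<in>Pow E. (-1) ^ card S * w S)"
begin

lemma s_pos: "s > 0"
  using s_power prime_p prime_gt_0_nat by auto

text \<open>The sign is -1 for odd \<open>s\<close>, and an even \<open>s\<close> forces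
  \<open>p = 2\<close>, where 1 and -1 agree.\<close>

lemma sign_square_dvd: "int p dvd 1 + (-1) ^ (s * s)"
proof (cases "even s")
  case True
  then have "even p" using s_power by auto
  then have "p = 2" using prime_p by (metis primes_dvd_imp_eq two_is_prime_nat)
  with True show ?thesis by simp
qed simp

text \<open>The fixed point congruence is used twice: for \<open>g1\<close> on all subsets of
  \<open>H\<close>, then for \<open>g2\<close> on the \<open>g1\<close>-invariant ones, which
  \<open>g2\<close> permutes because the rotations commute.\<close>

lemma enumerator_cong_invariant_sum:
  assumes A: "A1 \<subseteq> V" "A2 \<subseteq> V" "A1 \<inter> A2 = {}"
    and g1: "rotates s g1 A1" and g2: "rotates s g2 A2"
    and H: "H \<subseteq> pairs V" "act g1 H = H" "act g2 H = H"
  shows "[(\<Sum>S\<in>Pow H. (-1) ^ card S * w S) =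
    (\<Sum>S | S \<subseteq> H \<and> act g1 S = S \<and> act g2 S = S. (-1) ^ card S * w S)] (mod int p)"
proof -
  let ?f = "\<lambda>S. (-1) ^ card S * w S"
  obtain d where d: "s = p ^ d" using s_power by auto
  have gV: "g1 permutes V" "g2 permutes V"
    using g1 g2 A permutes_subset by (auto simp: rotates_def)
  have id: "g1 ^^ (p ^ d) = id" "g2 ^^ (p ^ d) = id"
    using g1 g2 d by (auto simp: rotates_def)
  have comm: "g1 (g2 x) = g2 (g1 x)" for x
  proof -
    have p1: "g1 permutes A1" and p2: "g2 permutes A2"
      using g1 g2 by (auto simp: rotates_def)
    show ?thesis
      using A(3) permutes_in_image[OF p1, of x] permutes_in_image[OF p2, of x]
        permutes_not_in[OF p1] permutes_not_in[OF p2]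
      by (cases "x \<in> A1"; cases "x \<in> A2") (auto simp: disjoint_iff)
  qed
  have comm': "act g1 (act g2 S) = act g2 (act g1 S)" for S
    by (simp add: image_image comm)
  have fin: "finite H" using finite_subset[OF H(1) finite_pairs[OF finite_V]] .
  define X where "X = {S \<in> Pow H. act g1 S = S}"
  have inv: "?f (act g S) = ?f S" if "g permutes V" "S \<subseteq> H" for g S
    using that H(1) w_invariant[of g S] card_act[of g V S] by auto
  have "[sum ?f (Pow H) = sum ?f X] (mod int p)"
    unfolding X_def
  proof (rule sum_cong_sum_fixed_points[OF prime_p, where d = d])
    show "act g1 ` Pow H \<subseteq> Pow H" using H(2) by blast
  qed (use fin inv gV id in \<open>auto simp: act_funpow\<close>)
  moreover have "[sum ?f X = sum ?f {S\<in>X. act g2 S = S}] (mod int p)"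
  proof (rule sum_cong_sum_fixed_points[OF prime_p, where d = d])
    show "act g2 ` X \<subseteq> X"
    proof safe
      fix S assume "S \<in> X"
      then have S: "S \<subseteq> H" "act g1 S = S" by (auto simp: X_def)
      have "act g2 S \<subseteq> H" using S H(3) by blast
      then show "act g2 S \<in> X" using S comm'[of S] by (simp add: X_def)
    qed
  qed (use fin inv gV id in \<open>auto simp: act_funpow X_def\<close>)
  moreover have "{S\<in>X. act g2 S = S} = {S. S \<subseteq> H \<and> act g1 S = S \<and> act g2 S = S}"
    by (auto simp: X_def)
  ultimately show ?thesis by (auto intro: cong_trans)
qed

text \<open>The invariant subsets of the join come in pairs \<open>S\<close>,
  \<open>S \<union> ?K\<close> with \<open>S \<subseteq> G\<close> invariant, and the signs in a
  pair are opposite modulo \<open>p\<close>. By induction all pairs with \<open>S \<noteq> G\<close>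
  cancel; if \<open>w (G \<union> ?K)\<close> were 0, the pair of \<open>G\<close> would leave a
  unit.\<close>

lemma join_invariant:
  assumes A: "A1 \<subseteq> V" "A2 \<subseteq> V" "A1 \<inter> A2 = {}" "card A1 = s" "card A2 = s"
    and g1: "rotates s g1 A1" and g2: "rotates s g2 A2"
    and G: "G \<subseteq> pairs V" "act g1 G = G" "act g2 G = G" "G \<inter> biclique A1 A2 = {}" "w G = 1"
  shows "w (G \<union> biclique A1 A2) = 1"
proof -
  let ?K = "biclique A1 A2"
  let ?f = "\<lambda>S. (-1) ^ card S * w S"
  have K: "?K \<subseteq> pairs V" using A biclique_subset_pairs by blast
  have K_ne: "?K \<noteq> {}"
    using A s_pos card_biclique[OF A(3)] by (metis card.empty mult_is_0 not_gr0)
  have finK: "finite ?K" using finite_subset[OF K finite_pairs[OF finite_V]] .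
  have cardK: "card ?K = s * s" using A card_biclique by metis
  have p1: "g1 permutes A1" and p2: "g2 permutes A2"
    using g1 g2 by (auto simp: rotates_def)
  have "g1 ` A2 = A2"
    using permutes_not_in[OF p1] A(3) by (force simp: disjoint_iff image_iff)
  moreover have "g2 ` A1 = A1"
    using permutes_not_in[OF p2] A(3) by (force simp: disjoint_iff image_iff)
  ultimately have actK: "act g1 ?K = ?K" "act g2 ?K = ?K"
    using permutes_image[OF p1] permutes_image[OF p2] by (simp_all add: act_biclique)
  have "finite G" using finite_subset[OF G(1) finite_pairs[OF finite_V]] .
  then show ?thesis using G
  proof (induction G rule: finite_psubset_induct)
    case (psubset G)
    note G = psubset.prems
    define H where "H = G \<union> ?K"
    define I where "I = {S. S \<subseteq> G \<and> act g1 S = S \<and> act g2 S = S}"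
    have H: "H \<subseteq> pairs V" "act g1 H = H" "act g2 H = H"
      using G K actK by (auto simp: H_def image_Un)
    have finI: "finite I" using psubset.hyps by (simp add: I_def)
    have GI: "G \<in> I" using G by (simp add: I_def)
    have fixed_eq: "{S. S \<subseteq> H \<and> act g1 S = S \<and> act g2 S = S} = I \<union> (\<lambda>S. S \<union> ?K) ` I" (is "?L = ?R")
    proof
      show "?R \<subseteq> ?L" using actK by (auto simp: I_def H_def image_Un)
      show "?L \<subseteq> ?R"
      proof
        fix S assume S: "S \<in> ?L"
        show "S \<in> ?R"
        proof (cases "S \<inter> ?K = {}")
          case True
          then show ?thesis using S by (auto simp: I_def H_def)
        next
          case False
          have KS: "?K \<subseteq> S"
            by (rule biclique_subset_invariant[OF g1 g2 A(3) _ _ False]) (use S in auto)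
          have "inj ((`) g1)" "inj ((`) g2)"
            using permutes_inj[OF p1] permutes_inj[OF p2] by (auto intro: inj_on_image)
          then have "act g1 (S - ?K) = S - ?K" "act g2 (S - ?K) = S - ?K"
            using S actK by (simp_all add: image_set_diff)
          then have "S - ?K \<in> I" using S by (auto simp: I_def H_def)
          moreover have "S = (S - ?K) \<union> ?K" using KS by auto
          ultimately show ?thesis by blast
        qed
      qed
    qed
    have disj: "S \<inter> ?K = {}" if "S \<in> I" for S using that G(4) by (auto simp: I_def)
    have f_union: "?f (S \<union> ?K) = (-1) ^ card S * (-1) ^ (s * s) * w (S \<union> ?K)" if "S \<in> I" for S
    proof -
      have "card (S \<union> ?K) = card S + s * s"
        using disj[OF that] finK that psubset.hyps cardK
        by (subst card_Un_disjoint) (auto simp: I_def intro: finite_subset)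
      then show ?thesis by (simp add: power_add)
    qed
    define h where "h = (\<lambda>S. (-1) ^ card S * (w S + (-1) ^ (s * s) * w (S \<union> ?K)))"
    \<comment> \<open>By minimality both values of \<open>w\<close> in \<open>h S\<close> are 1 for \<open>S \<noteq> G\<close>, so only \<open>h G\<close> survives modulo \<open>p\<close>.\<close>
    have "sum ?f {S. S \<subseteq> H \<and> act g1 S = S \<and> act g2 S = S} = sum ?f I + sum ?f ((\<lambda>S. S \<union> ?K) ` I)"
      unfolding fixed_eq
    proof (rule sum.union_disjoint)
      show "I \<inter> (\<lambda>S. S \<union> ?K) ` I = {}" using disj K_ne by blast
    qed (use finI in auto)
    also have "sum ?f ((\<lambda>S. S \<union> ?K) ` I) = (\<Sum>S\<in>I. ?f (S \<union> ?K))"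
    proof (rule sum.reindex_cong[where l = "\<lambda>S. S \<union> ?K"])
      show "inj_on (\<lambda>S. S \<union> ?K) I"
        using disj by (intro inj_onI) (metis Un_Diff Diff_cancel Diff_triv Un_empty_right)
    qed auto
    also have "sum ?f I + (\<Sum>S\<in>I. ?f (S \<union> ?K)) = sum h I"
      unfolding sum.distrib[symmetric] h_def
      by (rule sum.cong[OF refl]) (simp only: f_union distrib_left mult.assoc)
    finally have "[(\<Sum>S\<in>Pow H. ?f S) = sum h I] (mod int p)"
      using enumerator_cong_invariant_sum[OF A(1-3) g1 g2 H] by metis
    moreover have "int p dvd (\<Sum>S\<in>Pow H. ?f S)"
      using vanish[OF H(1) A] by (simp add: H_def)
    ultimately have "int p dvd sum h I" using cong_dvd_iff by blast
    moreover have "int p dvd h S" if S: "S \<in> I - {G}" for S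
    proof -
      have SG: "S \<subset> G" "act g1 S = S" "act g2 S = S" using S by (auto simp: I_def)
      have "w S = 1" using w_antimono[of S G] SG G by auto
      moreover have "w (S \<union> ?K) = 1"
        using SG G \<open>w S = 1\<close> by (intro psubset.IH) auto
      ultimately show ?thesis using sign_square_dvd by (simp add: h_def)
    qed
    then have "int p dvd sum h (I - {G})" by (rule dvd_sum)
    moreover have "sum h I = h G + sum h (I - {G})" using finI GI by (simp add: sum.remove)
    ultimately have "int p dvd h G" by (metis dvd_add_left_iff)
    then have hG: "int p dvd 1 + (-1) ^ (s * s) * w (G \<union> ?K)"
      using G(5) dvd_mult[of "int p" "h G" "(-1) ^ card G"] by (simp add: h_def)
    have "w (G \<union> ?K) \<noteq> 0"
    proof
      assume "w (G \<union> ?K) = 0"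
      then have "int p dvd 1" using hG by simp
      then show False using prime_p by auto
    qed
    then show ?case using w_range[of "G \<union> ?K"] G(1) K by auto
  qed
qed

end

section \<open>Graphs given by relations\<close>

text \<open>Describing graphs by relations turns inclusion and invariance into implications about
  two vertices.\<close>

definition graph_of :: "'v set \<Rightarrow> ('v \<Rightarrow> 'v \<Rightarrow> bool) \<Rightarrow> 'v set set" where
  "graph_of V r = {{u, v} |u v. u \<in> V \<and> v \<in> V \<and> u \<noteq> v \<and> r u v}"

lemma graph_of_subset_pairs: "graph_of V r \<subseteq> pairs V"
  by (auto simp: graph_of_def)

lemma graph_of_mono:
  assumes "\<And>u v. u \<in> V \<Longrightarrow> v \<in> V \<Longrightarrow> u \<noteq> v \<Longrightarrow> r u v \<Longrightarrow> r' u v"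
  shows "graph_of V r \<subseteq> graph_of V r'"
  using assms unfolding graph_of_def by blast

text \<open>The image has as many edges as the finite graph itself, so one inclusion, hence one
  implication for \<open>r\<close>, suffices.\<close>

lemma act_graph_of:
  assumes V: "finite V" and g: "g permutes V"
    and r: "\<And>u v. u \<in> V \<Longrightarrow> v \<in> V \<Longrightarrow> u \<noteq> v \<Longrightarrow> r u v \<Longrightarrow> r (g u) (g v)"
  shows "act g (graph_of V r) = graph_of V r"
proof (rule card_subset_eq)
  show "finite (graph_of V r)"
    using finite_subset[OF graph_of_subset_pairs finite_pairs[OF V]] .
  show "act g (graph_of V r) \<subseteq> graph_of V r"
  proof safe
    fix e assume "e \<in> graph_of V r"
    then obtain u v where e: "e = {u, v}" "u \<in> V" "v \<in> V" "u \<noteq> v" "r u v"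
      by (auto simp: graph_of_def)
    have "g u \<in> V" "g v \<in> V" "g u \<noteq> g v"
      using e permutes_in_image[OF g] permutes_inj[OF g] by (auto dest: injD)
    then show "g ` e \<in> graph_of V r"
      using e r[of u v] by (auto simp: graph_of_def)
  qed
  show "card (act g (graph_of V r)) = card (graph_of V r)"
    using card_act[OF g] .
qed

section \<open>Rotations of enumerated blocks\<close>

definition rotation :: "nat \<Rightarrow> (nat \<Rightarrow> 'v) \<Rightarrow> 'v \<Rightarrow> 'v" where
  "rotation s e v = (if v \<in> e ` {..<s} then e ((inv_into {..<s} e v + 1) mod s) else v)"

lemma rotation_enum:
  assumes "inj_on e {..<s}" "z < s"
  shows "rotation s e (e z) = e ((z + 1) mod s)"
  using assms by (simp add: rotation_def)

lemma rotation_outside: "v \<notin> e ` {..<s} \<Longrightarrow> rotation s e v = v"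
  by (simp add: rotation_def)

lemma funpow_rotation_enum:
  assumes "inj_on e {..<s}" "z < s"
  shows "(rotation s e ^^ i) (e z) = e ((z + i) mod s)"
proof (induction i)
  case (Suc i)
  have "(z + i) mod s < s" using assms by simp
  then show ?case
    using Suc assms by (simp add: rotation_enum mod_Suc_eq)
qed (use assms in simp)

lemma rotates_rotation:
  assumes e: "inj_on e {..<s}" and s: "s > 0"
  shows "rotates s (rotation s e) (e ` {..<s})"
proof -
  let ?g = "rotation s e"
  have period: "?g ^^ s = id"
  proof
    fix v
    show "(?g ^^ s) v = id v"
    proof (cases "v \<in> e ` {..<s}")
      case True
      then show ?thesis using funpow_rotation_enum[OF e] by auto
    next
      case False
      then show ?thesis
        using funpow_mult_fixed[where h = ?g and m = 1 and q = s and x = v]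
        by (simp add: rotation_outside)
    qed
  qed
  have "bij_betw ?g (e ` {..<s}) (e ` {..<s})"
  \<comment> \<open>The period \<open>s\<close> makes the power \<open>s - 1\<close> the
    inverse.\<close>
  proof (rule bij_betw_byWitness[where f' = "?g ^^ (s - 1)"])
    have Suc_s: "Suc (s - 1) = s" using s by simp
    show "\<forall>a\<in>e ` {..<s}. (?g ^^ (s - 1)) (?g a) = a"
      using period Suc_s by (metis comp_apply funpow_Suc_right id_apply)
    show "\<forall>a\<in>e ` {..<s}. ?g ((?g ^^ (s - 1)) a) = a"
      using period Suc_s by (metis comp_apply funpow.simps(2) id_apply)
    show "?g ` e ` {..<s} \<subseteq> e ` {..<s}"
      using s e by (auto simp: rotation_enum)
    show "(?g ^^ (s - 1)) ` e ` {..<s} \<subseteq> e ` {..<s}"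
      using s e by (auto simp: funpow_rotation_enum)
  qed
  then have "?g permutes e ` {..<s}"
    by (rule bij_imp_permutes) (simp add: rotation_outside)
  \<comment> \<open>The summand \<open>s\<close> avoids truncated subtraction:
    \<open>x + (s - x + y)\<close> is \<open>s + y\<close>.\<close>
  moreover have "\<exists>i. (?g ^^ i) (e x) = e y" if "x < s" "y < s" for x y
    using that funpow_rotation_enum[OF e that(1), of "s - x + y"] by (intro exI[of _ "s - x + y"]) simp
  ultimately show ?thesis
    using period by (auto simp: rotates_def)
qed

text \<open>For symmetric \<open>r\<close> this suffices for invariance under the rotation along
  \<open>e\<close>, and it can be checked by arithmetic on indices.\<close>

definition homogeneous :: "'v set \<Rightarrow> nat \<Rightarrow> (nat \<Rightarrow> 'v) \<Rightarrow> ('v \<Rightarrow> 'v \<Rightarrow> bool) \<Rightarrow> bool" where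
  "homogeneous V s e r \<longleftrightarrow>
     (\<forall>x<s. \<forall>y<s. r (e x) (e y) \<longrightarrow> r (e ((x + 1) mod s)) (e ((y + 1) mod s))) \<and>
     (\<forall>x<s. \<forall>y<s. \<forall>v\<in>V - e ` {..<s}. r (e x) v \<longrightarrow> r (e y) v)"

lemma homogeneous_rotation:
  assumes e: "inj_on e {..<s}" and sym: "symp r" and h: "homogeneous V s e r"
    and uv: "u \<in> V" "v \<in> V" "r u v"
  shows "r (rotation s e u) (rotation s e v)"
proof -
  have half: "r (rotation s e u) (rotation s e v)"
    if u: "u \<in> e ` {..<s}" and v: "v \<in> V" and r: "r u v" for u v
  proof -
    obtain x where x: "u = e x" "x < s" using u by auto
    then have xs: "(x + 1) mod s < s" by simp
    show ?thesis
    proof (cases "v \<in> e ` {..<s}")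
      case True
      then show ?thesis using h x r by (auto simp: homogeneous_def rotation_enum[OF e])
    next
      case False
      then have "r (e ((x + 1) mod s)) v"
        using h x xs v r unfolding homogeneous_def by blast
      then show ?thesis using x False by (simp add: rotation_enum[OF e] rotation_outside)
    qed
  qed
  show ?thesis
  proof (cases "u \<in> e ` {..<s} \<or> v \<in> e ` {..<s}")
    case True
    then show ?thesis using half[of u v] half[of v u] uv sympD[OF sym] by blast
  next
    case False
    then show ?thesis using uv by (simp add: rotation_outside)
  qed
qed

abbreviation across :: "'v set \<Rightarrow> 'v set \<Rightarrow> 'v \<Rightarrow> 'v \<Rightarrow> bool" where
  "across A B u v \<equiv> u \<in> A \<and> v \<in> B \<or> u \<in> B \<and> v \<in> A"

section \<open>Joining enumerated blocks\<close>

context vanishing_enumerator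
begin

definition good :: "('v \<Rightarrow> 'v \<Rightarrow> bool) \<Rightarrow> bool" where
  "good r \<longleftrightarrow> w (graph_of V r) = 1"

lemma good_antimono:
  assumes "good r'" "\<And>u v. u \<in> V \<Longrightarrow> v \<in> V \<Longrightarrow> u \<noteq> v \<Longrightarrow> r u v \<Longrightarrow> r' u v"
  shows "good r"
  using assms w_antimono[OF graph_of_mono[of V r r'] graph_of_subset_pairs] by (simp add: good_def)

text \<open>\<open>join_invariant\<close> wants no edges between the blocks. Any such edges are
  deleted first, which monotonicity permits; the graph stays invariant because each rotation
  preserves both blocks. The join then restores them.\<close>

lemma good_join:
  assumes e1: "inj_on e1 {..<s}" "e1 ` {..<s} \<subseteq> V" and e2: "inj_on e2 {..<s}" "e2 ` {..<s} \<subseteq> V"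
    and disj: "e1 ` {..<s} \<inter> e2 ` {..<s} = {}"
    and sym: "symp r" and h1: "homogeneous V s e1 r" and h2: "homogeneous V s e2 r" and r: "good r"
  shows "good (\<lambda>u v. r u v \<or> across (e1 ` {..<s}) (e2 ` {..<s}) u v)"
proof -
  define A1 where "A1 = e1 ` {..<s}"
  define A2 where "A2 = e2 ` {..<s}"
  note A = e1(2)[folded A1_def] e2(2)[folded A2_def] disj[folded A1_def A2_def]
  have card: "card A1 = s" "card A2 = s"
    using e1 e2 by (simp_all add: A1_def A2_def card_image)
  have rot: "rotates s (rotation s e1) A1" "rotates s (rotation s e2) A2"
    using rotates_rotation e1 e2 s_pos by (auto simp: A1_def A2_def)
  define G where "G = graph_of V (\<lambda>u v. r u v \<and> \<not> across A1 A2 u v)"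
  have act_G: "act (rotation s e) G = G"
    if e: "inj_on e {..<s}" "homogeneous V s e r" "rotates s (rotation s e) (e ` {..<s})"
      "e ` {..<s} = A1 \<or> e ` {..<s} = A2" for e
    unfolding G_def
  proof (rule act_graph_of[OF finite_V])
    have perm: "rotation s e permutes e ` {..<s}" using e(3) by (simp add: rotates_def)
    then show "rotation s e permutes V"
      by (rule permutes_subset) (use e(4) A in auto)
    have "rotation s e x \<in> A1 \<longleftrightarrow> x \<in> A1" "rotation s e x \<in> A2 \<longleftrightarrow> x \<in> A2" for x
      using e(4) A(3) permutes_in_image[OF perm, of x] rotation_outside[of x e s] by (auto simp: disjoint_iff)
    then show "r (rotation s e u) (rotation s e v) \<and> \<not> across A1 A2 (rotation s e u) (rotation s e v)"
      if "u \<in> V" "v \<in> V" "r u v \<and> \<not> across A1 A2 u v" for u v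
      using homogeneous_rotation[OF e(1) sym e(2) that(1,2)] that(3) by simp
  qed
  have "w (G \<union> biclique A1 A2) = 1"
  proof (rule join_invariant[OF A card rot])
    show "G \<subseteq> pairs V" unfolding G_def by (rule graph_of_subset_pairs)
    show "act (rotation s e1) G = G" "act (rotation s e2) G = G"
      using act_G e1 e2 h1 h2 rot by (auto simp: A1_def A2_def)
    show "G \<inter> biclique A1 A2 = {}"
      by (auto simp: G_def graph_of_def biclique_def doubleton_eq_iff)
    show "w G = 1"
      using good_antimono[OF r, of "\<lambda>u v. r u v \<and> \<not> across A1 A2 u v"] by (simp add: good_def G_def)
  qed
  moreover have "G \<union> biclique A1 A2 = graph_of V (\<lambda>u v. r u v \<or> across A1 A2 u v)"
  proof
    show "G \<union> biclique A1 A2 \<subseteq> graph_of V (\<lambda>u v. r u v \<or> across A1 A2 u v)"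
    proof (rule Un_least)
      show "G \<subseteq> graph_of V (\<lambda>u v. r u v \<or> across A1 A2 u v)"
        unfolding G_def by (rule graph_of_mono) blast
      show "biclique A1 A2 \<subseteq> graph_of V (\<lambda>u v. r u v \<or> across A1 A2 u v)"
      proof
        fix x assume "x \<in> biclique A1 A2"
        then obtain a b where "x = {a, b}" "a \<in> A1" "b \<in> A2" by (auto simp: biclique_def)
        moreover from this have "a \<in> V" "b \<in> V" "a \<noteq> b" using A by auto
        ultimately show "x \<in> graph_of V (\<lambda>u v. r u v \<or> across A1 A2 u v)"
          unfolding graph_of_def by blast
      qed
    qed
    show "graph_of V (\<lambda>u v. r u v \<or> across A1 A2 u v) \<subseteq> G \<union> biclique A1 A2"
    proof
      fix x assume "x \<in> graph_of V (\<lambda>u v. r u v \<or> across A1 A2 u v)"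
      then obtain u v where x: "x = {u, v}" "u \<in> V" "v \<in> V" "u \<noteq> v" "r u v \<or> across A1 A2 u v"
        by (auto simp: graph_of_def)
      show "x \<in> G \<union> biclique A1 A2"
      proof (cases "across A1 A2 u v")
        case True
        then show ?thesis using x(1) insert_commute[of u v "{}"] unfolding biclique_def by auto
      next
        case False
        then show ?thesis using x unfolding G_def graph_of_def by blast
      qed
    qed
  qed
  ultimately show ?thesis by (simp add: good_def A1_def A2_def)
qed

end

text \<open>Blocks are single vertices here, so homogeneity is trivial and each join adds one edge.
  This covers \<open>k < p\<close>, where the clique construction has no room.\<close>

lemma (in vanishing_enumerator) good_complete_if_singleton:
  assumes "s = 1" and "w {} = 1"
  shows "good (\<lambda>_ _. True)"
proof -
  have "finite J \<Longrightarrow> J \<subseteq> {(u, v). u \<in> V \<and> v \<in> V \<and> u \<noteq> v} \<Longrightarrow>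
    good (\<lambda>u v. (u, v) \<in> J \<or> (v, u) \<in> J)" for J
  proof (induction J rule: finite_induct)
    case empty
    then show ?case using assms(2) by (simp add: good_def graph_of_def)
  next
    case (insert e J)
    obtain a b where e: "e = (a, b)" by (cases e)
    define r where "r u v \<longleftrightarrow> (u, v) \<in> J \<or> (v, u) \<in> J" for u v
    have "good (\<lambda>u v. r u v \<or> across ((\<lambda>_. a) ` {..<s}) ((\<lambda>_. b) ` {..<s}) u v)"
    proof (rule good_join)
      show "symp r" by (auto simp: symp_def r_def)
      show "good r" using insert.IH insert.prems unfolding r_def by blast
      show "homogeneous V s (\<lambda>_. a) r" "homogeneous V s (\<lambda>_. b) r"
        by (simp_all add: homogeneous_def)
    qed (use insert.prems e assms in \<open>auto simp: lessThan_Suc\<close>)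
    then show ?case
      by (rule good_antimono) (use assms e in \<open>auto simp: r_def lessThan_Suc\<close>)
  qed
  moreover have "finite {(u, v). u \<in> V \<and> v \<in> V \<and> u \<noteq> v}"
    by (rule finite_subset[of _ "V \<times> V"]) (use finite_V in auto)
  ultimately have "good (\<lambda>u v. (u, v) \<in> {(u, v). u \<in> V \<and> v \<in> V \<and> u \<noteq> v} \<or>
      (v, u) \<in> {(u, v). u \<in> V \<and> v \<in> V \<and> u \<noteq> v})"
    by blast
  then show ?thesis by (rule good_antimono) auto
qed

section \<open>Growing cliques\<close>

text \<open>The vertices from \<open>a + N\<close> on form a clique joined to everything from \<open>a\<close> on, and the \<open>N\<close> vertices
  from \<open>a\<close> on are split into consecutive cliques of size \<open>q\<close>.\<close>

definition clusters :: "nat \<Rightarrow> nat \<Rightarrow> nat \<Rightarrow> nat \<Rightarrow> nat \<Rightarrow> bool" where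
  "clusters a N q u v \<longleftrightarrow>
     a \<le> u \<and> a \<le> v \<and> (a + N \<le> u \<or> a + N \<le> v \<or> (u - a) div q = (v - a) div q)"

text \<open>The \<open>j\<close>-th block consists of every \<open>p\<close>-th clique of size \<open>q\<close>. It is enumerated so that its cliques
  are the residue classes modulo \<open>t\<close>, which makes it invariant under the rotation of its \<open>t * q\<close> elements.\<close>

definition block_enum :: "nat \<Rightarrow> nat \<Rightarrow> nat \<Rightarrow> nat \<Rightarrow> nat \<Rightarrow> nat \<Rightarrow> nat" where
  "block_enum a p q t j z = a + ((z mod t * p + j) * q + z div t)"

lemma div_block_enum:
  assumes "z < t * q"
  shows "(block_enum a p q t j z - a) div q = z mod t * p + j"
    and "(block_enum a p q t j z - a) mod q = z div t"
proof -
  have "z div t < q" using assms by (simp add: less_mult_imp_div_less mult.commute)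
  then show "(block_enum a p q t j z - a) div q = z mod t * p + j"
    and "(block_enum a p q t j z - a) mod q = z div t"
    by (simp_all add: block_enum_def)
qed

lemma inj_on_block_enum:
  assumes "j < p"
  shows "inj_on (block_enum a p q t j) {..<t * q}"
proof (rule inj_onI)
  fix x y assume xy: "x \<in> {..<t * q}" "y \<in> {..<t * q}" "block_enum a p q t j x = block_enum a p q t j y"
  then have "x mod t * p + j = y mod t * p + j" "x div t = y div t"
    using div_block_enum[of x t q a p j] div_block_enum[of y t q a p j] by auto
  then have "x mod t = y mod t" using assms by simp
  then show "x = y" using \<open>x div t = y div t\<close> by (metis div_mult_mod_eq)
qed

lemma image_block_enum:
  assumes j: "j < p" and q: "q > 0" and t: "t > 0"
  shows "block_enum a p q t j ` {..<t * q} =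
    {u \<in> {a..<a + p * (t * q)}. (u - a) div q mod p = j}" (is "?L = ?R")
proof
  show "?L \<subseteq> ?R"
  proof safe
    fix z assume z: "z < t * q"
    have "Suc (z mod t) * p \<le> t * p" using t by (intro mult_le_mono1) (simp add: Suc_le_eq)
    then have "z mod t * p + j < t * p" using j by simp
    then have "block_enum a p q t j z - a < t * p * q"
      using div_block_enum(1)[OF z, of a p j] q by (metis div_less_iff_less_mult)
    then show "block_enum a p q t j z \<in> {a..<a + p * (t * q)}"
      by (auto simp: block_enum_def mult_ac)
    show "(block_enum a p q t j z - a) div q mod p = j"
      using div_block_enum(1)[OF z, of a p j] j by simp
  qed
  show "?R \<subseteq> ?L"
  proof
    fix u assume u: "u \<in> ?R"
    define y where "y = u - a"
    \<comment> \<open>The inverse of the enumeration: the clique index divided by \<open>p\<close>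
      becomes the residue modulo \<open>t\<close>, the position in the clique becomes the
      quotient.\<close>
    define z where "z = y div q div p + t * (y mod q)"
    have "y < t * p * q" using u by (auto simp: y_def mult_ac)
    then have c: "y div q div p < t"
      using q j by (simp add: less_mult_imp_div_less)
    have zt: "z mod t = y div q div p" "z div t = y mod q"
      using c by (simp_all add: z_def)
    have "z < t * q"
      using zt(2) q t by (metis div_less_iff_less_mult mod_less_divisor mult.commute)
    moreover have "block_enum a p q t j z = u"
    proof -
      have "z mod t * p + j = y div q"
        using u zt(1) div_mult_mod_eq[of "y div q" p] by (simp add: y_def)
      then show ?thesis
        using u zt(2) div_mult_mod_eq[of y q] by (simp add: block_enum_def y_def)
    qed
    ultimately show "u \<in> ?L" by blast
  qed
qed

section \<open>From the edgeless to the complete graph on the vertices below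
  \<open>k\<close>\<close>

locale vanishing_enumerator_nat = vanishing_enumerator "{..<k}" w p s
  for k :: nat and w :: "nat set set \<Rightarrow> int" and p s :: nat
begin

text \<open>The block of a vertex is its clique index modulo \<open>p\<close>, so \<open>p\<close>
  consecutive cliques lie in different blocks, and joining all blocks pairwise merges them.\<close>

lemma good_clusters_step:
  assumes ak: "a + p * s \<le> k" and s: "s = t * q"
    and start: "good (clusters a (p * s) q)"
  shows "good (clusters a (p * s) (p * q))"
proof -
  have p0: "p > 0" using prime_p prime_gt_0_nat by blast
  have tq: "t > 0" "q > 0" using s_pos s by auto
  define bl where "bl u = (u - a) div q mod p" for u
  define T where "T = {a..<a + p * s}"
  \<comment> \<open>\<open>J\<close> records the pairs of blocks joined so far.\<close>
  define r where "r J u v \<longleftrightarrow> clusters a (p * s) q u v \<or>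
    u \<in> T \<and> v \<in> T \<and> ((bl u, bl v) \<in> J \<or> (bl v, bl u) \<in> J)" for J u v
  let ?P = "{(i, j). i < p \<and> j < p \<and> i \<noteq> j}"
  let ?e = "block_enum a p q t"
  have inj: "inj_on (?e j) {..<s}" if "j < p" for j
    using inj_on_block_enum[OF that] by (simp add: s)
  have img: "?e j ` {..<s} = {u \<in> T. bl u = j}" if "j < p" for j
    using image_block_enum[OF that tq(2,1), of a] by (simp add: s T_def bl_def)
  have sym: "symp (r J)" for J
    by (auto simp: symp_def r_def clusters_def)
  have hom: "homogeneous {..<k} s (?e j) (r J)" if j: "j < p" and J: "J \<subseteq> ?P" for j J
    unfolding homogeneous_def
  proof (intro conjI allI impI ballI)
    have e: "?e j x \<in> T" "bl (?e j x) = j" if "x < s" for x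
      using img[OF j] that by blast+
    \<comment> \<open>No block is joined to itself, so inside it only the old cliques count. They
      are the residue classes modulo \<open>t\<close>, and the shift modulo \<open>s\<close>
      respects these because \<open>t\<close> divides \<open>s\<close>.\<close>
    have r_iff: "r J (?e j x) (?e j y) \<longleftrightarrow> x mod t = y mod t" if "x < s" "y < s" for x y
    proof -
      have "(j, j) \<notin> J" using J by auto
      then have "r J (?e j x) (?e j y) \<longleftrightarrow> clusters a (p * s) q (?e j x) (?e j y)"
        using e that by (simp add: r_def)
      also have "\<dots> \<longleftrightarrow> (?e j x - a) div q = (?e j y - a) div q"
        using e(1)[OF that(1)] e(1)[OF that(2)] by (auto simp: clusters_def T_def)
      also have "\<dots> \<longleftrightarrow> x mod t = y mod t"
        using that p0 by (simp add: div_block_enum s)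
      finally show ?thesis .
    qed
    fix x y assume xy: "x < s" "y < s"
    show "r J (?e j ((x + 1) mod s)) (?e j ((y + 1) mod s))" if "r J (?e j x) (?e j y)"
    proof -
      have "x mod t = y mod t" using that r_iff xy by simp
      then have "(x + 1) mod t = (y + 1) mod t" by (metis mod_add_left_eq)
      then show ?thesis
        using r_iff[of "(x + 1) mod s" "(y + 1) mod s"] s_pos by (simp add: s mod_mod_cancel)
    qed
    fix v assume v: "v \<in> {..<k} - ?e j ` {..<s}" and rv: "r J (?e j x) v"
    show "r J (?e j y) v"
    proof (cases "v \<in> T")
      case True
      \<comment> \<open>A vertex of another block lies in another old clique, so only
        \<open>J\<close> can relate it to block \<open>j\<close>, and then to all of that
        block.\<close>
      then have "bl v \<noteq> j" using v img[OF j] by blast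
      have "\<not> clusters a (p * s) q (?e j x) v"
        using True e[OF xy(1)] \<open>bl v \<noteq> j\<close> by (auto simp: clusters_def T_def bl_def)
      then show ?thesis using rv e xy by (simp add: r_def)
    next
      case False
      then show ?thesis
        using rv e(1)[OF xy(1)] e(1)[OF xy(2)] by (auto simp: r_def clusters_def T_def)
    qed
  qed
  have joined: "finite J \<Longrightarrow> J \<subseteq> ?P \<Longrightarrow> good (r J)" for J
  proof (induction J rule: finite_induct)
    case empty
    show ?case by (rule good_antimono[OF start]) (simp add: r_def)
  next
    case (insert ij J)
    obtain i j where ij: "ij = (i, j)" by (cases ij)
    then have ij': "i < p" "j < p" "i \<noteq> j" using insert.prems by auto
    have TV: "T \<subseteq> {..<k}" using ak by (auto simp: T_def)
    have "good (\<lambda>u v. r J u v \<or> across (?e i ` {..<s}) (?e j ` {..<s}) u v)"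
    proof (rule good_join[OF inj[OF ij'(1)] _ inj[OF ij'(2)] _ _ sym hom[OF ij'(1)] hom[OF ij'(2)]])
      show "?e i ` {..<s} \<subseteq> {..<k}" "?e j ` {..<s} \<subseteq> {..<k}" "?e i ` {..<s} \<inter> ?e j ` {..<s} = {}"
        using img ij' TV by auto
    qed (use insert in auto)
    then show ?case
      by (rule good_antimono) (use ij img[OF ij'(1)] img[OF ij'(2)] in \<open>auto simp: r_def\<close>)
  qed
  have "finite ?P" by (rule finite_subset[of _ "{..<p} \<times> {..<p}"]) auto
  then have "good (r ?P)" using joined by blast
  then show ?thesis
  proof (rule good_antimono)
    fix u v assume uv: "clusters a (p * s) (p * q) u v"
    show "r ?P u v"
    proof (cases "u \<in> T \<and> v \<in> T")
      case False
      then show ?thesis using uv by (auto simp: r_def clusters_def T_def)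
    next
      case True
      \<comment> \<open>In a new clique the old clique indices agree after division by
        \<open>p\<close>. If the blocks agree too, the indices are equal; otherwise the vertices
        have been joined.\<close>
      then have "(u - a) div q div p = (v - a) div q div p"
        using uv by (auto simp: clusters_def T_def div_mult2_eq mult.commute[of p])
      then have "(u - a) div q = (v - a) div q" if "bl u = bl v"
        using that by (metis bl_def div_mult_mod_eq)
      then show ?thesis using True uv p0 by (auto simp: r_def clusters_def bl_def)
    qed
  qed
qed

text \<open>Merging cliques of size \<open>p ^ i\<close> requires \<open>p ^ i\<close> to divide
  \<open>s = p ^ d\<close>. The last step, \<open>i = d\<close>, ends with a single clique of size
  \<open>p * s\<close>.\<close>

lemma good_clique:
  assumes ak: "a + p * s \<le> k" and start: "good (clusters a (p * s) 1)"
  shows "good (\<lambda>u v. a \<le> u \<and> a \<le> v)"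
proof -
  obtain d where d: "s = p ^ d" using s_power by auto
  have "i \<le> Suc d \<Longrightarrow> good (clusters a (p * s) (p ^ i))" for i
  proof (induction i)
    case (Suc i)
    have "s = p ^ (d - i) * p ^ i" using Suc.prems d by (simp flip: power_add)
    then show ?case using good_clusters_step[OF ak] Suc by simp
  qed (use start in simp)
  from this[of "Suc d"] have "good (clusters a (p * s) (p * s))" by (simp add: d)
  then show ?thesis
  proof (rule good_antimono)
    fix u v assume "a \<le> u \<and> a \<le> v"
    then show "clusters a (p * s) (p * s) u v"
      by (cases "a + p * s \<le> u \<or> a + p * s \<le> v") (auto simp: clusters_def less_diff_conv2)
  qed
qed

text \<open>The \<open>s\<close> vertices from \<open>a\<close> on are made independent and then
  joined, as one block, to all vertices from \<open>a + s\<close> on. As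
  \<open>p * s \<ge> s\<close>, the result contains the starting graph of
  \<open>good_clique\<close>.\<close>

lemma good_clique_extend:
  assumes ak: "a + p * s \<le> k" and start: "good (\<lambda>u v. Suc a \<le> u \<and> Suc a \<le> v)"
  shows "good (\<lambda>u v. a \<le> u \<and> a \<le> v)"
proof -
  have "2 * s \<le> p * s" using prime_ge_2_nat[OF prime_p] by simp
  then have ak2: "a + 2 * s \<le> k" and past_s: "\<And>u. a + p * s \<le> u \<Longrightarrow> a + s \<le> u"
    using ak by linarith+
  define r where "r y u v \<longleftrightarrow> a + s \<le> u \<and> a + s \<le> v \<or> across {a..<a + s} {a + s..<y} u v" for y u v
  have img: "(\<lambda>z. b + z) ` {..<s} = {b..<b + s}" for b
    by (simp add: lessThan_atLeast0 image_add_atLeastLessThan add.commute)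
  have "a + s \<le> y \<Longrightarrow> y \<le> k \<Longrightarrow> good (r y)" for y
  proof (induction y rule: dec_induct)
    case base
    show ?case by (rule good_antimono[OF start]) (use s_pos in \<open>auto simp: r_def\<close>)
  next
    case (step y)
    define y' where "y' = min y (k - s)"
    have y': "a + s \<le> y'" "y' \<le> y" "y' + s \<le> k" "Suc y \<le> y' + s"
      using step ak2 s_pos by (auto simp: y'_def)
    have "good (\<lambda>u v. r y' u v \<or> across ((\<lambda>z. a + z) ` {..<s}) ((\<lambda>z. y' + z) ` {..<s}) u v)"
    proof (rule good_join)
      show "good (r y')"
        by (rule good_antimono[OF step.IH]) (use step.prems y' in \<open>auto simp: r_def\<close>)
      show "symp (r y')" by (auto simp: symp_def r_def)
      show "homogeneous {..<k} s (\<lambda>z. a + z) (r y')"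
        unfolding homogeneous_def img by (auto simp: r_def)
      show "homogeneous {..<k} s (\<lambda>z. y' + z) (r y')"
        unfolding homogeneous_def img using y' by (auto simp: r_def)
    qed (use y' ak2 in \<open>auto simp: img\<close>)
    then show ?case
      by (rule good_antimono) (use y' in \<open>auto simp: r_def img\<close>)
  qed
  then have "good (r k)" using ak2 by simp
  then have "good (clusters a (p * s) 1)"
    by (rule good_antimono) (auto simp: r_def clusters_def dest: past_s)
  then show ?thesis using good_clique[OF ak] by simp
qed

text \<open>On the last \<open>p * s\<close> vertices the starting graph of
  \<open>good_clique\<close> has no edges, so the first clique comes for free; it then grows
  downwards to vertex 0.\<close>

lemma good_complete:
  assumes "p * s \<le> k" and "w {} = 1"
  shows "good (\<lambda>_ _. True)"
proof -
  have "graph_of {..<k} (clusters (k - p * s) (p * s) 1) = {}"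
    using assms(1) by (auto simp: graph_of_def clusters_def)
  then have base: "good (\<lambda>u v. k - p * s \<le> u \<and> k - p * s \<le> v)"
    using assms by (intro good_clique) (simp_all add: good_def)
  have "good (\<lambda>u v. a \<le> u \<and> a \<le> v)" if "a \<le> k - p * s" for a
    using that
  proof (induction a rule: inc_induct)
    case (step a)
    show ?case by (rule good_clique_extend) (use step assms(1) in auto)
  qed (rule base)
  from this[of 0] show ?thesis by simp
qed

end

section \<open>Transfer to graph properties\<close>

lemma fin_simple_graph_iff: "fin_simple_graph (V, E) \<longleftrightarrow> finite V \<and> E \<subseteq> pairs V"
  by (auto simp: fin_simple_graph_def pairs_def)

lemma act_pairs:
  assumes "bij_betw f U V"
  shows "act f (pairs U) = pairs V"
proof
  show "act f (pairs U) \<subseteq> pairs V"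
    by (rule act_pairs_subset) (use assms in \<open>auto simp: bij_betw_def\<close>)
  show "pairs V \<subseteq> act f (pairs U)"
  proof
    fix e assume "e \<in> pairs V"
    then obtain u v where e: "e = {u, v}" "u \<in> V" "v \<in> V" "u \<noteq> v" by (rule pairsE)
    then obtain x y where xy: "x \<in> U" "y \<in> U" "f x = u" "f y = v"
      using assms by (metis bij_betw_imp_surj_on imageE)
    then have "e = f ` {x, y}" "{x, y} \<in> pairs U" using e by auto
    then show "e \<in> act f (pairs U)" by blast
  qed
qed

lemma inj_on_act:
  assumes "inj_on f U"
  shows "inj_on (act f) (Pow (pairs U))"
proof -
  have "pairs U \<subseteq> Pow U" by (auto simp: pairs_def)
  then have "inj_on ((`) f) (pairs U)"
    using inj_on_image_Pow[OF assms] inj_on_subset by blast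
  then show ?thesis by (rule inj_on_image_Pow)
qed

lemma card_act_inj_on:
  assumes "inj_on f U" "S \<subseteq> pairs U"
  shows "card (act f S) = card S"
proof (rule card_image)
  have "S \<subseteq> Pow U" using assms(2) by (auto simp: pairs_def)
  then show "inj_on ((`) f) S"
    using inj_on_image_Pow[OF assms(1)] inj_on_subset by blast
qed

lemma graph_iso_act:
  assumes f: "bij_betw f U V" and E: "E \<subseteq> pairs U"
  shows "graph_iso (U, E) (V, act f E)"
  unfolding graph_iso_def
proof (intro exI[of _ f] conjI ballI)
  fix u v assume uv: "u \<in> verts (U, E)" "v \<in> verts (U, E)"
  have inj: "inj_on ((`) f) (Pow U)"
    using f by (auto simp: bij_betw_def intro: inj_on_image_Pow)
  have "E \<subseteq> Pow U" using E by (auto simp: pairs_def)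
  then have "f ` {u, v} \<in> act f E \<longleftrightarrow> {u, v} \<in> E"
    using inj_on_image_mem_iff[OF inj, of "{u, v}" E] uv by auto
  then show "{u, v} \<in> edges (U, E) \<longleftrightarrow> {f u, f v} \<in> edges (V, act f E)" by simp
qed (use f in simp)

text \<open>Rewrites the enumerator of a transported graph as a sum over edge sets on
  \<open>U\<close>, the form used in \<open>vanish\<close>.\<close>

lemma alternating_enumerator_act:
  assumes f: "inj_on f U" and E: "E \<subseteq> pairs U"
  shows "alternating_enumerator \<Phi> (V, act f E) =
    (-1) ^ card E * (\<Sum>S\<in>Pow E. (-1) ^ card S * \<Phi> (V, act f S))"
proof -
  have "inj_on (act f) (Pow E)"
    using inj_on_act[OF f] by (rule inj_on_subset) (use E in auto)
  moreover have "act f ` Pow E = Pow (act f E)"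
    by (rule image_Pow_surj) simp
  ultimately have "(\<Sum>S\<in>Pow (act f E). (-1) ^ card S * \<Phi> (V, S)) =
      (\<Sum>S\<in>Pow E. (-1) ^ card (act f S) * \<Phi> (V, act f S))"
    by (metis (no_types, lifting) sum.reindex_cong)
  also have "\<dots> = (\<Sum>S\<in>Pow E. (-1) ^ card S * \<Phi> (V, act f S))"
    by (rule sum.cong) (use E card_act_inj_on[OF f] in auto)
  finally show ?thesis
    by (simp add: alternating_enumerator_def spanning_subgraph_def card_act_inj_on[OF f E])
qed

lemma vanishing_enumerator_of_property:
  fixes \<Phi> :: "'a graph \<Rightarrow> int"
  assumes property: "graph_property k \<Phi>" and mono: "monotone_property \<Phi>"
    and p: "prime p" and s: "s = p ^ d"
    and V: "finite V" "card V = k" and f: "bij_betw f {..<k} V"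
    and vanish: "\<And>H. fin_simple_graph H \<Longrightarrow> card (verts H) = k \<Longrightarrow>
      \<exists>K. complete_bipartite s s K \<and> subgraph K H \<Longrightarrow> [alternating_enumerator \<Phi> H = 0] (mod int p)"
  shows "vanishing_enumerator {..<k} (\<lambda>S. \<Phi> (V, act f S)) p s"
proof
  have inj: "inj_on f {..<k}" and img: "f ` {..<k} = V"
    using f by (auto simp: bij_betw_def)
  have simple: "fin_simple_graph (V, act f S)" if "S \<subseteq> pairs {..<k}" for S
    using act_pairs_subset[OF inj _ that, of V] img V by (simp add: fin_simple_graph_iff)
  show "\<Phi> (V, act f S) = 0 \<or> \<Phi> (V, act f S) = 1" if "S \<subseteq> pairs {..<k}" for S
    using property simple[OF that] by (auto simp: graph_property_def)
  show "\<Phi> (V, act f S) = 1" if "S \<subseteq> T" "T \<subseteq> pairs {..<k}" "\<Phi> (V, act f T) = 1" for S T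
  proof -
    have "act f S \<subseteq> edges (V, act f T)" using that(1) by auto
    then have "\<Phi> (spanning_subgraph (V, act f T) (act f S)) = 1"
      using mono simple[OF that(2)] that(3) unfolding monotone_property_def by blast
    then show ?thesis by (simp add: spanning_subgraph_def)
  qed
  show "\<Phi> (V, act f (act g S)) = \<Phi> (V, act f S)"
    if g: "g permutes {..<k}" and S: "S \<subseteq> pairs {..<k}" for g S
  proof -
    \<comment> \<open>Conjugation by \<open>f\<close> turns \<open>g\<close> into a permutation of
      \<open>V\<close>, to which isomorphism invariance applies.\<close>
    define h where "h = f \<circ> g \<circ> inv_into {..<k} f"
    have h: "bij_betw h V V"
      unfolding h_def
      using bij_betw_trans[OF bij_betw_trans[OF bij_betw_inv_into[OF f] permutes_imp_bij[OF g]] f]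
      by (simp add: comp_assoc)
    have "act h (act f S) = act f (act g S)"
    proof -
      have "h ` f ` e = f ` g ` e" if "e \<in> S" for e
      proof -
        have "e \<subseteq> {..<k}" using that S by (auto simp: pairs_def)
        then show ?thesis
          unfolding image_image by (intro image_cong) (auto simp: h_def inv_into_f_f[OF inj])
      qed
      then have "(\<lambda>e. h ` f ` e) ` S = (\<lambda>e. f ` g ` e) ` S" by (rule image_cong[OF refl])
      then show ?thesis by (simp only: image_image)
    qed
    moreover have "act f S \<subseteq> pairs V" using simple[OF S] by (simp add: fin_simple_graph_iff)
    ultimately have "graph_iso (V, act f S) (V, act f (act g S))"
      using graph_iso_act[OF h] by metis
    moreover have "act g S \<subseteq> pairs {..<k}"
      by (rule act_pairs_subset[OF _ _ S])
        (use permutes_image[OF g] inj_on_subset[OF permutes_inj[OF g]] in auto)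
    ultimately show ?thesis
      using property simple[OF S] simple[of "act g S"] unfolding graph_property_def by metis
  qed
  show "int p dvd (\<Sum>S\<in>Pow E. (-1) ^ card S * \<Phi> (V, act f S))"
    if E: "E \<subseteq> pairs {..<k}" and A: "A \<subseteq> {..<k}" and B: "B \<subseteq> {..<k}"
      and disj: "A \<inter> B = {}" and card: "card A = s" "card B = s" and AB: "biclique A B \<subseteq> E" for E A B
  proof -
    let ?H = "(V, act f E)"
    have "complete_bipartite s s (f ` A \<union> f ` B, biclique (f ` A) (f ` B))"
      unfolding complete_bipartite_def
    proof (intro exI conjI)
      show "finite (f ` A)" "finite (f ` B)" using A B finite_subset by blast+
      show "f ` A \<inter> f ` B = {}" using inj_on_image_Int[OF inj A B] disj by simp
      show "card (f ` A) = s" "card (f ` B) = s"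
        using card_image[OF inj_on_subset[OF inj A]] card_image[OF inj_on_subset[OF inj B]] card by simp_all
    qed (simp add: biclique_def)
    moreover have "subgraph (f ` A \<union> f ` B, biclique (f ` A) (f ` B)) ?H"
    proof -
      have "biclique (f ` A) (f ` B) \<subseteq> act f E"
      proof
        fix e assume "e \<in> biclique (f ` A) (f ` B)"
        then obtain a b where "e = f ` {a, b}" "a \<in> A" "b \<in> B" by (auto simp: biclique_def)
        moreover from this have "{a, b} \<in> E" using AB by (auto simp: biclique_def)
        ultimately show "e \<in> act f E" by blast
      qed
      then show ?thesis using A B img by (auto simp: subgraph_def)
    qed
    ultimately have "[alternating_enumerator \<Phi> ?H = 0] (mod int p)"
      using vanish[OF simple[OF E]] V by auto
    then have "int p dvd (-1) ^ card E * (\<Sum>S\<in>Pow E. (-1) ^ card S * \<Phi> (V, act f S))"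
      unfolding alternating_enumerator_act[OF inj E] by (simp add: cong_0_iff)
    \<comment> \<open>Multiplying by the leading sign once more cancels it.\<close>
    then show ?thesis
      using dvd_mult[of "int p" _ "(-1) ^ card E"] by (metis left_minus_one_mult_self)
  qed
qed (use p s in auto)

section \<open>Conclusion by contradiction\<close>

lemma nontrivial_property_witnesses:
  assumes "graph_property k \<Phi>" "\<not> trivial_property k \<Phi>"
  obtains G0 G1 where "fin_simple_graph G0" "card (verts G0) = k" "\<Phi> G0 = 0"
    "fin_simple_graph G1" "card (verts G1) = k" "\<Phi> G1 = 1"
proof -
  have zero_one: "\<Phi> G = 0 \<or> \<Phi> G = 1" if "fin_simple_graph G" for G
    using assms(1) that unfolding graph_property_def by blast
  have "\<not> (\<forall>G. fin_simple_graph G \<longrightarrow> card (verts G) = k \<longrightarrow> \<Phi> G = c)" for c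
    using assms(2) unfolding trivial_property_def by blast
  from this[of 0] this[of 1] show ?thesis using zero_one that by metis
qed

text \<open>If no such graph existed, the edgeless graph, which inherits the property from
  \<open>G1\<close>, would pass it to the complete graph on the vertices of \<open>G0\<close>, and
  monotonicity would pass it to \<open>G0\<close>.\<close>

lemma exists_nonvanishing_with_biclique:
  fixes \<Phi> :: "'a graph \<Rightarrow> int"
  assumes property: "graph_property k \<Phi>" and mono: "monotone_property \<Phi>"
    and nontriv: "\<not> trivial_property k \<Phi>"
    and p: "prime p" and s: "s = p ^ d" "s = 1 \<or> p * s \<le> k"
  shows "\<exists>H. fin_simple_graph H \<and> card (verts H) = k \<and>
    (\<exists>K. complete_bipartite s s K \<and> subgraph K H) \<and> \<not> [alternating_enumerator \<Phi> H = 0] (mod int p)"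
proof (rule ccontr)
  assume none: "\<not> ?thesis"
  obtain G0 G1 where G0: "fin_simple_graph G0" "card (verts G0) = k" "\<Phi> G0 = 0"
    and G1: "fin_simple_graph G1" "card (verts G1) = k" "\<Phi> G1 = 1"
    using nontrivial_property_witnesses[OF property nontriv] .
  define V where "V = verts G0"
  have V: "finite V" "card V = k" using G0 by (auto simp: V_def fin_simple_graph_def)
  then obtain f where f: "bij_betw f {..<k} V"
    using finite_same_card_bij[of "{..<k}" V] by auto
  interpret vanishing_enumerator "{..<k}" "\<lambda>S. \<Phi> (V, act f S)" p s
    by (rule vanishing_enumerator_of_property[OF property mono p s(1) V f]) (use none in blast)
  interpret vanishing_enumerator_nat k "\<lambda>S. \<Phi> (V, act f S)" p s ..
  have empty: "\<Phi> (V, act f {}) = 1"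
  proof -
    have fin: "finite (verts G1)" using G1 by (simp add: fin_simple_graph_def)
    then obtain h where "bij_betw h (verts G1) V"
      using finite_same_card_bij[of "verts G1" V] V G1 by auto
    then have "graph_iso (verts G1, {}) (V, {})" using graph_iso_act[of h "verts G1" V "{}"] by simp
    moreover have "\<Phi> (verts G1, {}) = 1"
      using mono G1 unfolding monotone_property_def spanning_subgraph_def by blast
    moreover have "fin_simple_graph (verts G1, {})" "fin_simple_graph (V, {})"
      using fin V by (auto simp: fin_simple_graph_iff)
    ultimately show ?thesis using property unfolding graph_property_def by (metis image_empty)
  qed
  have "good (\<lambda>_ _. True)"
    using s(2) good_complete_if_singleton good_complete empty by blast
  moreover have "graph_of {..<k} (\<lambda>_ _. True) = pairs {..<k}"
    by (auto simp: graph_of_def elim!: pairsE)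
  ultimately have "\<Phi> (V, pairs V) = 1" by (simp add: good_def act_pairs[OF f])
  moreover have "fin_simple_graph (V, pairs V)" using V by (simp add: fin_simple_graph_iff)
  moreover have "edges G0 \<subseteq> pairs V" using G0(1) by (auto simp: fin_simple_graph_def pairs_def V_def)
  ultimately have "\<Phi> (spanning_subgraph (V, pairs V) (edges G0)) = 1"
    using mono unfolding monotone_property_def by simp
  then show False using G0(3) by (simp add: spanning_subgraph_def V_def)
qed

theorem theorem5p5:
  fixes k p :: nat and \<Phi> :: "'a graph \<Rightarrow> int"
  assumes "k \<ge> 1"
    and "prime p"
    and "graph_property k \<Phi>"
    and "monotone_property \<Phi>"
    and "\<not> trivial_property k \<Phi>"
  shows "\<exists>H :: 'a graph. fin_simple_graph H \<and> card (verts H) = k \<and>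
           \<not> [alternating_enumerator \<Phi> H = 0] (mod int p) \<and>
           (\<exists>l :: nat. real l > real k / (real p)\<^sup>2 \<and>
              (\<exists>K. complete_bipartite l l K \<and> subgraph K H))"
proof -
  have p2: "p \<ge> 2" using assms(2) by (rule prime_ge_2_nat)
  \<comment> \<open>For \<open>k < p\<close> take \<open>d = 0\<close>; otherwise
    \<open>p ^ (d + 1)\<close> is the largest power of \<open>p\<close> that is at most
    \<open>k\<close>. The second bound says that \<open>l = p ^ d\<close> exceeds
    \<open>k / p\<^sup>2\<close>.\<close>
  obtain d where d: "p ^ d = 1 \<or> p * p ^ d \<le> k" "k < p\<^sup>2 * p ^ d"
  proof (cases "k < p")
    case True
    have "p \<le> p\<^sup>2" using p2 by (simp add: power2_eq_square)
    then show ?thesis using True that[of 0] by simp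
  next
    case False
    obtain n where n: "p ^ n \<le> k" "k < p ^ (n + 1)"
      using ex_power_ivl1[OF p2 assms(1)] by auto
    have "n \<noteq> 0" using n False by (intro notI) simp
    then obtain m where "n = Suc m" using not0_implies_Suc by blast
    then show ?thesis using n that[of m] by (simp add: power2_eq_square)
  qed
  have "real k < (real p)\<^sup>2 * real (p ^ d)"
    using d(2) by (metis of_nat_less_iff of_nat_mult of_nat_power)
  then have "real (p ^ d) > real k / (real p)\<^sup>2"
    using p2 by (simp add: divide_less_eq mult.commute)
  then show ?thesis
    using exists_nonvanishing_with_biclique[OF assms(3-5,2) refl d(1)] by blast
qed

end
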